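(* Let $a,q$ be integers with $q\ge2$, $1\le a<q$ and $\gcd(a,q)=1$. Then $$\Delta_1(a/q,1-a/q;1)=2\log q-\sum_{u=1}^{q-1}\cos\left(\frac{2\pi au}{q}\right)\log\left(2-2\cos\frac{2\pi u}{q}\right).$$ For every integer $j\ge2$, $$\Delta_j(a/q,1-a/q;1)=(-1)^j(j-1)!\left[2\zeta(j)-\frac{2q^j}{\varphi(q)}\sum_{\substack{\chi\ (\mathrm{mod}\ q)\\ \chi(-1)=1}}\overline{\chi(a)}\,L(j,\chi)\right],$$ where the sum is over all even Dirichlet characters modulo $q$, including the principal character.
   Context: With $\psi=\Gamma'/\Gamma$ the digamma function and $\psi^{(k)}$ its $k$-th derivative, $$\Delta_j(\alpha,1-\alpha;1)=2\psi^{(j-1)}(1)-\psi^{(j-1)}(1-\alpha)-\psi^{(j-1)}(\alpha).$$ For a Dirichlet character $\chi$ modulo $q$, $L(s,\chi)=\sum_{n\ge1}\chi(n)n^{-s}$ for $\operatorname{Re}s>1$; $\varphi$ is Euler's totient function and $\zeta$ the Riemann zeta function. *)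

theory Defs
  imports "HOL-Complex_Analysis.Complex_Analysis" "HOL-Number_Theory.Number_Theory"
begin

definition digamma :: "complex \<Rightarrow> complex" where
  "digamma z = deriv Gamma z / Gamma z"

text \<open>
  \<open>Delta j \<alpha>\<close> is $\Delta_j(\alpha, 1-\alpha; 1)$, for $j \ge 1$ and $\alpha$ not an integer;
  \<open>(deriv ^^ k) digamma\<close> is the \<open>k\<close>-th derivative $\psi^{(k)}$.
\<close>
definition Delta :: "nat \<Rightarrow> complex \<Rightarrow> complex" where
  "Delta j \<alpha> = 2 * (deriv ^^ (j - 1)) digamma 1
     - (deriv ^^ (j - 1)) digamma (1 - \<alpha>) - (deriv ^^ (j - 1)) digamma \<alpha>"

text \<open>
  Characters are functions on all integers, extended by zero to arguments not coprime to \<open>q\<close>.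
\<close>
definition dirichlet_characters :: "nat \<Rightarrow> (int \<Rightarrow> complex) set" where
  "dirichlet_characters q = {\<xi>.
     (\<forall>m n. \<xi> (m * n) = \<xi> m * \<xi> n) \<and>
     (\<forall>n. \<xi> (n + int q) = \<xi> n) \<and>
     (\<forall>n. \<xi> n \<noteq> 0 \<longleftrightarrow> coprime n (int q))}"

text \<open>
  The Dirichlet series below are the intended functions only in the half-plane of absolute
  convergence \<open>Re s > 1\<close>; the analytic continuations are not needed. Index \<open>n\<close> of each series
  is the summand for the positive integer \<open>Suc n\<close>.
\<close>
definition Dirichlet_L :: "complex \<Rightarrow> (int \<Rightarrow> complex) \<Rightarrow> complex" where
  "Dirichlet_L s \<xi> = (\<Sum>n. \<xi> (int (Suc n)) * of_nat (Suc n) powr (- s))"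

definition riemann_zeta :: "complex \<Rightarrow> complex" where
  "riemann_zeta s = (\<Sum>n. of_nat (Suc n) powr (- s))"

lemma dirichlet_character_mod:
  assumes "\<xi> \<in> dirichlet_characters q"
  shows "\<xi> (n mod int q) = \<xi> n"
proof -
  have per: "\<xi> (m + int q) = \<xi> m" for m
    using assms by (simp add: dirichlet_characters_def)
  have shift: "\<xi> (m + int k * int q) = \<xi> m" for m k
  proof (induction k)
    case (Suc k)
    have "\<xi> (m + int (Suc k) * int q) = \<xi> ((m + int k * int q) + int q)"
      by (simp add: algebra_simps)
    then show ?case using Suc per by simp
  qed simp
  show ?thesis
  proof (cases "n div int q \<ge> 0")
    case True
    have "n mod int q + int (nat (n div int q)) * int q = n"
      using True by simp
    then show ?thesis using shift by metis
  next
    case False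
    have "n + int (nat (- (n div int q))) * int q = n mod int q"
      using False by (simp add: minus_div_mult_eq_mod [symmetric])
    then show ?thesis using shift by metis
  qed
qed

lemma dirichlet_character_power_totient:
  assumes "\<xi> \<in> dirichlet_characters q" "q > 0" "coprime n (int q)"
  shows "\<xi> n ^ totient q = 1"
proof -
  have mult: "\<xi> (m * k) = \<xi> m * \<xi> k" for m k
    using assms(1) by (simp add: dirichlet_characters_def)
  have "\<xi> 1 \<noteq> 0" using assms(1) by (simp add: dirichlet_characters_def)
  moreover have "\<xi> 1 = \<xi> 1 * \<xi> 1" using mult[of 1 1] by simp
  ultimately have one: "\<xi> 1 = 1" by simp
  have pow: "\<xi> (m ^ k) = \<xi> m ^ k" for m k
    by (induction k) (simp_all add: one mult)
  define r where "r = nat (n mod int q)"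
  have r: "int r = n mod int q" using assms(2) by (simp add: r_def)
  have "coprime (int r) (int q)" using assms(2,3) r by simp
  then have "[r ^ totient q = 1] (mod q)" by (intro euler_theorem) simp
  then have "[int r ^ totient q = 1] (mod int q)"
    by (metis cong_int_iff of_nat_1 of_nat_power)
  then have "\<xi> (int r ^ totient q) = \<xi> 1"
    using dirichlet_character_mod[OF assms(1)] unfolding cong_def by metis
  moreover have "\<xi> (int r) = \<xi> n"
    using r dirichlet_character_mod[OF assms(1)] by simp
  ultimately show ?thesis using pow one by simp
qed

lemma finite_dirichlet_characters:
  assumes "q > 0"
  shows "finite (dirichlet_characters q)"
proof -
  let ?I = "{0..<int q}"
  let ?R = "insert 0 {z :: complex. z ^ totient q = 1}"
  have tot: "totient q \<ge> 1" using assms by (simp add: Suc_leI)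
  then have "finite ?R" using finite_roots_unity by simp
  then have fin: "finite (PiE ?I (\<lambda>_. ?R))" by (intro finite_PiE) auto
  have inj: "inj_on (\<lambda>\<xi>. restrict \<xi> ?I) (dirichlet_characters q)"
  proof (rule inj_onI)
    fix \<xi> \<psi> assume c: "\<xi> \<in> dirichlet_characters q" "\<psi> \<in> dirichlet_characters q"
      and eq: "restrict \<xi> ?I = restrict \<psi> ?I"
    show "\<xi> = \<psi>"
    proof
      fix n
      have "n mod int q \<in> ?I" using assms by simp
      then have "\<xi> (n mod int q) = \<psi> (n mod int q)"
        using eq by (metis restrict_apply')
      then show "\<xi> n = \<psi> n" using c dirichlet_character_mod by metis
    qed
  qed
  have "(\<lambda>\<xi>. restrict \<xi> ?I) ` dirichlet_characters q \<subseteq> PiE ?I (\<lambda>_. ?R)"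
  proof
    fix f assume "f \<in> (\<lambda>\<xi>. restrict \<xi> ?I) ` dirichlet_characters q"
    then obtain \<xi> where c: "\<xi> \<in> dirichlet_characters q" and f: "f = restrict \<xi> ?I" by blast
    have "\<xi> n \<in> ?R" for n
      using c dirichlet_character_power_totient[OF c assms, of n]
      by (cases "coprime n (int q)") (auto simp: dirichlet_characters_def)
    then show "f \<in> PiE ?I (\<lambda>_. ?R)" unfolding f by auto
  qed
  then show ?thesis using inj fin by (meson finite_imageD finite_subset)
qed

end

theory Submission
  imports Defs
begin

text \<open>
  Both formulas are obtained by writing \<open>\<psi>\<close> and its derivatives as series over an arithmetic
  progression and detecting the residue class modulo \<open>q\<close> by an orthogonality relation:
  additive characters for \<open>j = 1\<close>, Dirichlet characters for \<open>j \<ge> 2\<close>. Since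
  \<open>\<Delta>\<^sub>j\<close> is symmetric under \<open>\<alpha> \<mapsto> 1 - \<alpha>\<close>, the progressions
  \<open>a\<close> and \<open>-a\<close> modulo \<open>q\<close> occur together, and only the even part of each orthogonality
  relation survives: cosines in the first case, even characters in the second.

  For \<open>j \<ge> 2\<close>, up to the sign \<open>(-1)^j\<close> and the factor \<open>(j-1)!\<close>, the derivative of
  order \<open>j-1\<close> of \<open>\<psi>\<close> at \<open>r/q\<close> is \<open>q^j\<close> times the sum of \<open>n^(-j)\<close> over the positive
  \<open>n \<equiv> r\<close> modulo \<open>q\<close> (\<open>sums_residue_class\<close>). The sum of \<open>cnj (\<xi> a) * \<xi> n\<close> over the
  even characters is \<open>totient q / 2\<close> times the sum of the indicators of \<open>n \<equiv> a\<close> and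
  \<open>n \<equiv> -a\<close> (\<open>sum_even_dirichlet_characters\<close>), and exchanging it with the absolutely convergent
  Dirichlet series gives the claim. The orthogonality relation rests on the fact that characters of
  a finite abelian group separate points, proved by extending a character from a subgroup one
  generator at a time (\<open>group_character_adjoin\<close>).

  For \<open>j = 1\<close> the sums of \<open>1/(k + \<alpha>)\<close>, \<open>1/(k + 1 - \<alpha>)\<close> and \<open>1/(k + 1)\<close>
  diverge separately, but their combination in \<open>\<Delta>\<^sub>1\<close> converges: for \<open>\<alpha> = a/q\<close> its terms
  are the sums over blocks of \<open>q\<close> consecutive terms of the series \<open>\<Sum> c(n)/n\<close> for a
  \<open>q\<close>-periodic \<open>c\<close> of mean zero. Expanding \<open>c\<close> into cosines of nonzero frequency reduces the sum
  to \<open>\<Sum> cos(n \<theta>)/n = - ln(2 - 2 cos \<theta>)/2\<close>, the boundary case of the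
  logarithmic series (\<open>Ln_series_boundary\<close>). This produces the coefficients
  \<open>1 - cos(2 \<pi> a u/q)\<close>; the part with coefficient \<open>1\<close> sums to \<open>2 ln q\<close>
  (\<open>sum_ln_roots_of_unity\<close>).
\<close>

section \<open>Characters of finite abelian groups\<close>

text \<open>
  Only the values on the carrier matter, so that a character of a subgroup \<open>H\<close> is a character of
  \<open>G\<lparr>carrier := H\<rparr>\<close> and extending it leaves the type of the function unchanged.
\<close>
definition group_character :: "('a, 'b) monoid_scheme \<Rightarrow> ('a \<Rightarrow> complex) \<Rightarrow> bool" where
  "group_character G f \<longleftrightarrow>
     (\<forall>x\<in>carrier G. f x \<noteq> 0) \<and>
     (\<forall>x\<in>carrier G. \<forall>y\<in>carrier G. f (x \<otimes>\<^bsub>G\<^esub> y) = f x * f y)"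

lemma (in group) group_character_one:
  assumes "group_character G f"
  shows "f \<one> = 1"
  using assms unfolding group_character_def
  by (metis l_one mult_cancel_left1 one_closed)

lemma (in group) group_character_int_pow:
  assumes "group_character G f" "x \<in> carrier G"
  shows "f (x [^] (i::int)) = f x powi i"
proof -
  have nat: "f (x [^] n) = f x ^ n" for n :: nat
    using assms group_character_one[OF assms(1)]
    by (induction n) (auto simp: group_character_def)
  have inv: "f (inv y) = inverse (f y)" if "y \<in> carrier G" for y
  proof -
    have "f y * f (inv y) = 1"
      using assms(1) that group_character_one[OF assms(1)]
      unfolding group_character_def by (metis inv_closed r_inv)
    then show ?thesis by (metis inverse_unique)
  qed
  show ?thesis
  proof (cases i rule: int_cases2)
    case (nonneg n)
    then show ?thesis by (simp add: int_pow_int nat)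
  next
    case (nonpos n)
    then show ?thesis
      using assms(2) by (simp add: int_pow_neg_int inv nat power_int_minus)
  qed
qed

text \<open>
  The extension sends \<open>h \<otimes> x [^] i\<close> to \<open>f h * w powi i\<close>. For this to be well defined, \<open>f\<close> must agree
  with \<open>w powi d\<close> at every power \<open>x [^] d\<close> lying in \<open>H\<close>; minimality of \<open>k\<close> forces \<open>k\<close> to divide such a
  \<open>d\<close>, and then the agreement follows from \<open>w ^ k = f (x [^] k)\<close>. Leaving the root \<open>w\<close> free allows a
  nontrivial value to be prescribed at \<open>x\<close>.
\<close>
lemma (in comm_group) group_character_adjoin:
  assumes H: "subgroup H G" and f: "group_character (G\<lparr>carrier := H\<rparr>) f"
    and x: "x \<in> carrier G" and k: "k > 0" "x [^] k \<in> H"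
    and least: "\<And>i. 0 < i \<Longrightarrow> i < k \<Longrightarrow> x [^] i \<notin> H"
    and w: "w ^ k = f (x [^] (k::nat))"
  shows "\<exists>H' f'. subgroup H' G \<and> H \<subseteq> H' \<and> x \<in> H' \<and>
           group_character (G\<lparr>carrier := H'\<rparr>) f' \<and> (\<forall>h\<in>H. f' h = f h) \<and> f' x = w"
proof -
  interpret H: group "G\<lparr>carrier := H\<rparr>"
    by (rule subgroup_imp_group[OF H])
  have sub: "h \<in> carrier G" if "h \<in> H" for h
    using that subgroup.subset[OF H] by blast
  have fm: "f (h \<otimes> h') = f h * f h'" if "h \<in> H" "h' \<in> H" for h h'
    using f that by (simp add: group_character_def)
  have f0: "f h \<noteq> 0" if "h \<in> H" for h
    using f that by (simp add: group_character_def)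
  have w0: "w \<noteq> 0" using w k f0 by (metis power_eq_0_iff)
  \<comment> \<open>Division of \<open>d\<close> by \<open>k\<close> leaves a remainder that is also an exponent with \<open>x [^] i \<in> H\<close>, hence zero.\<close>
  have f_pow: "f (x [^] d) = w powi d" if d: "x [^] d \<in> H" for d :: int
  proof -
    have yc: "x [^] (int k * e) = (x [^] k) [^] e" for e :: int
      using x by (simp add: int_pow_int flip: int_pow_pow)
    have yH: "x [^] (int k * e) \<in> H" for e
      unfolding yc by (rule subgroup_int_pow_closed[OF H k(2)])
    have "d mod int k = d + int k * (- (d div int k))"
      by (simp flip: minus_mult_div_eq_mod)
    then have "x [^] (d mod int k) = x [^] d \<otimes> x [^] (int k * (- (d div int k)))"
      using x int_pow_mult by metis
    then have "x [^] (d mod int k) \<in> H"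
      using subgroup.m_closed[OF H d yH] by (simp only:)
    then have "x [^] nat (d mod int k) \<in> H"
      using k(1) by (simp add: int_pow_def2)
    then have "nat (d mod int k) = 0"
      using least[of "nat (d mod int k)"] k(1)
      by (cases "nat (d mod int k) = 0") (auto simp: nat_less_iff)
    then have "d mod int k = 0"
      using k(1) pos_mod_sign[of "int k" d] by linarith
    then have "d = int k * (d div int k)" by auto
    then obtain e where e: "d = int k * e" by blast
    have "f (x [^] d) = f ((x [^] k) [^] e)" by (simp add: e yc)
    also have "\<dots> = f (x [^] k) powi e"
      using H.group_character_int_pow[OF f, of "x [^] k" e] k(2)
      by (simp add: int_pow_consistent[OF H])
    also have "\<dots> = w powi d" by (simp add: e w[symmetric] power_int_mult)
    finally show ?thesis .
  qed
  have unique: "f h * w powi i = f h' * w powi i'"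
    if "h \<in> H" "h' \<in> H" "h \<otimes> x [^] i = h' \<otimes> x [^] i'" for h h' and i i' :: int
  proof -
    have *: "x [^] (i - i') = inv h \<otimes> h'"
    proof -
      have c: "h \<in> carrier G" "h' \<in> carrier G" "x [^] i \<in> carrier G" "x [^] i' \<in> carrier G"
        using that sub x by simp_all
      have "x [^] i = inv h \<otimes> (h \<otimes> x [^] i)" using c by (simp flip: m_assoc)
      also have "\<dots> = inv h \<otimes> h' \<otimes> x [^] i'" using c that(3) by (simp add: m_assoc)
      finally have "x [^] i \<otimes> inv (x [^] i') = inv h \<otimes> h'" using c by (simp add: m_assoc)
      then show ?thesis using x by (simp add: int_pow_diff)
    qed
    have ih: "inv h \<in> H" using H that(1) by (rule subgroup.m_inv_closed)
    then have "inv h \<otimes> h' \<in> H" using H that(2) by (simp add: subgroup.m_closed)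
    then have "f (inv h \<otimes> h') = w powi (i - i')" using f_pow * by metis
    then have "w powi i = f (inv h \<otimes> h') * w powi i'" using w0 by (simp add: power_int_diff)
    moreover have "f h * f (inv h \<otimes> h') = f h'"
      using fm[OF that(1) \<open>inv h \<otimes> h' \<in> H\<close>] that sub by (simp flip: m_assoc)
    ultimately show ?thesis
      by (metis mult.assoc)
  qed
  define H' where "H' = {h \<otimes> x [^] i | h (i::int). h \<in> H}"
  define f' where "f' y = (THE v. \<exists>h\<in>H. \<exists>i::int. y = h \<otimes> x [^] i \<and> v = f h * w powi i)" for y
  have f': "f' (h \<otimes> x [^] i) = f h * w powi i" if "h \<in> H" for h and i :: int
    unfolding f'_def using that by (intro the_equality) (auto dest: unique)
  have HH': "h \<otimes> x [^] i \<in> H'" if "h \<in> H" for h and i :: int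
    using that unfolding H'_def by blast
  have mult: "(h \<otimes> x [^] i) \<otimes> (h' \<otimes> x [^] i') = (h \<otimes> h') \<otimes> x [^] (i + i')"
    if "h \<in> H" "h' \<in> H" for h h' and i i' :: int
    using that sub x by (simp add: int_pow_mult m_ac)
  have oneH: "\<one> \<in> H" using H by (rule subgroup.one_closed)
  have subH': "subgroup H' G"
  proof (rule subgroupI)
    show "H' \<subseteq> carrier G" using sub x by (auto simp: H'_def)
    show "H' \<noteq> {}" using HH' oneH by blast
    show "inv y \<in> H'" if y: "y \<in> H'" for y
    proof -
      obtain h i where hi: "h \<in> H" "y = h \<otimes> x [^] (i::int)" using y unfolding H'_def by blast
      then have "inv y = inv h \<otimes> x [^] (- i)"
        using sub x by (simp add: inv_mult int_pow_neg)
      then show ?thesis using HH' subgroup.m_inv_closed[OF H hi(1)] by simp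
    qed
    show "y \<otimes> z \<in> H'" if yz: "y \<in> H'" "z \<in> H'" for y z
    proof -
      obtain h i h' i' where "h \<in> H" "y = h \<otimes> x [^] (i::int)" "h' \<in> H" "z = h' \<otimes> x [^] (i'::int)"
        using yz unfolding H'_def by blast
      then show ?thesis using mult HH' subgroup.m_closed[OF H] by simp
    qed
  qed
  have char: "group_character (G\<lparr>carrier := H'\<rparr>) f'"
  proof -
    have "f' y \<noteq> 0" if "y \<in> H'" for y
      using that f' f0 w0 by (auto simp: H'_def)
    moreover have "f' (y \<otimes> z) = f' y * f' z" if y: "y \<in> H'" and z: "z \<in> H'" for y z
    proof -
      obtain h i where hi: "h \<in> H" "y = h \<otimes> x [^] (i::int)" using y unfolding H'_def by blast
      obtain h' i' where hi': "h' \<in> H" "z = h' \<otimes> x [^] (i'::int)" using z unfolding H'_def by blast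
      have "f' (y \<otimes> z) = f (h \<otimes> h') * w powi (i + i')"
        using hi hi' mult f' subgroup.m_closed[OF H] by simp
      then show ?thesis
        using hi hi' f' fm w0 by (simp add: power_int_add)
    qed
    ultimately show ?thesis by (simp add: group_character_def)
  qed
  have hx: "h = h \<otimes> x [^] (0::int)" if "h \<in> H" for h using that sub by simp
  have xx: "x = \<one> \<otimes> x [^] (1::int)" using x by simp
  have "H \<subseteq> H'" using HH' hx by (metis subsetI)
  moreover have "x \<in> H'" using HH'[OF oneH] xx by metis
  moreover have "f' h = f h" if "h \<in> H" for h
    using f'[OF that, of 0] hx[OF that] by simp
  moreover have "f' x = w"
    using f'[OF oneH, of 1] xx H.group_character_one[OF f] by simp
  ultimately show ?thesis
    using subH' char by (intro exI[of _ H'] exI[of _ f'] conjI ballI)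
qed

text \<open>
  Nonzero complex numbers have roots of every order, so elements can be adjoined until the subgroup
  is all of \<open>G\<close>.
\<close>
lemma (in comm_group) group_character_extend:
  assumes fin: "finite (carrier G)"
    and "subgroup H G" "group_character (G\<lparr>carrier := H\<rparr>) f"
  shows "\<exists>f'. group_character G f' \<and> (\<forall>h\<in>H. f' h = f h)"
  using assms(2,3)
proof (induction "card (carrier G) - card H" arbitrary: H f rule: less_induct)
  case less
  note H = \<open>subgroup H G\<close> and f = \<open>group_character (G\<lparr>carrier := H\<rparr>) f\<close>
  have HG: "H \<subseteq> carrier G" using H by (rule subgroup.subset)
  show ?case
  proof (cases "H = carrier G")
    case True
    then show ?thesis using f by auto
  next
    case False
    then obtain x where x: "x \<in> carrier G" "x \<notin> H" using HG by blast
    define P where "P i \<longleftrightarrow> i > 0 \<and> x [^] i \<in> H" for i :: nat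
    \<comment> \<open>Such an exponent exists: \<open>x [^] ord x = \<one>\<close> lies in every subgroup.\<close>
    define k where "k = (LEAST i. P i)"
    have "P (ord x)"
      using x ord_ge_1[OF fin x(1)] subgroup.one_closed[OF H] by (simp add: P_def)
    then have "P k" unfolding k_def by (rule LeastI)
    then have k: "k > 0" "x [^] k \<in> H" by (simp_all add: P_def)
    have least: "\<not> P i" if "i < k" for i
      using not_less_Least that unfolding k_def by blast
    have "f (x [^] k) \<noteq> 0" using f k by (simp add: group_character_def)
    then have "exp (Ln (f (x [^] k)) / of_nat k) ^ k = f (x [^] k)"
      using k by (simp flip: exp_of_nat_mult)
    then obtain w where "w ^ k = f (x [^] k)" by blast
    then obtain H' f' where H': "subgroup H' G" "H \<subseteq> H'" "x \<in> H'"
        "group_character (G\<lparr>carrier := H'\<rparr>) f'" "\<forall>h\<in>H. f' h = f h"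
      using group_character_adjoin[OF H f x(1) k, of w] least by (auto simp: P_def)
    have "card H < card H'"
      using H' x fin by (intro psubset_card_mono) (auto dest: subgroup.subset finite_subset)
    moreover have "card H' \<le> card (carrier G)"
      using H' fin by (intro card_mono subgroup.subset)
    ultimately obtain g where "group_character G g" "\<forall>h\<in>H'. g h = f' h"
      using less.hyps[OF _ H'(1,4)] by fastforce
    then show ?thesis using H' by (metis subsetD)
  qed
qed

text \<open>
  If \<open>x\<close> has order \<open>k > 1\<close>, the trivial character of \<open>{\<one>}\<close> extends to a character taking any
  prescribed \<open>k\<close>-th root of unity as its value at \<open>x\<close>, in particular one different from \<open>1\<close>.
\<close>
lemma (in comm_group) group_characters_separate:
  assumes fin: "finite (carrier G)" and x: "x \<in> carrier G" "x \<noteq> \<one>"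
  shows "\<exists>f. group_character G f \<and> f x \<noteq> 1"
proof -
  define k where "k = ord x"
  have k1: "k > 0" using ord_ge_1[OF fin x(1)] by (simp add: k_def)
  moreover have "k \<noteq> 1" using ord_eq_1[OF x(1)] x(2) by (simp add: k_def)
  ultimately have "card {z::complex. z ^ k = 1} \<noteq> 1"
    by (simp add: card_complex_roots_unity)
  then have "{z::complex. z ^ k = 1} \<noteq> {1}" by (metis is_singletonI is_singleton_altdef)
  then obtain w :: complex where w: "w ^ k = 1" "w \<noteq> 1" by auto
  have triv: "group_character (G\<lparr>carrier := {\<one>}\<rparr>) (\<lambda>_. 1)"
    by (simp add: group_character_def)
  have "x [^] k \<in> {\<one>}" using x by (simp add: k_def)
  moreover have "x [^] i \<notin> {\<one>}" if "0 < i" "i < k" for i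
    using that x(1) by (auto simp: pow_eq_id k_def dest: dvd_imp_le)
  ultimately have "\<exists>H' f'. subgroup H' G \<and> {\<one>} \<subseteq> H' \<and> x \<in> H' \<and>
      group_character (G\<lparr>carrier := H'\<rparr>) f' \<and> (\<forall>h\<in>{\<one>}. f' h = 1) \<and> f' x = w"
    using w(1) by (intro group_character_adjoin[OF triv_subgroup triv x(1) k1]) simp_all
  then obtain H' f' where H': "subgroup H' G" "group_character (G\<lparr>carrier := H'\<rparr>) f'"
      and x': "x \<in> H'" "f' x = w" by auto
  obtain g where "group_character G g" "\<forall>h\<in>H'. g h = f' h"
    using group_character_extend[OF fin H'] by auto
  then show ?thesis using x' w(2) by auto
qed

section \<open>Orthogonality of Dirichlet characters\<close>

lemma dirichlet_character_one:
  assumes "\<xi> \<in> dirichlet_characters q"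
  shows "\<xi> 1 = 1"
proof -
  have "\<xi> (1 * 1) = \<xi> 1 * \<xi> 1" "\<xi> 1 \<noteq> 0"
    using assms unfolding dirichlet_characters_def by (blast, simp)
  then show ?thesis by simp
qed

lemma dirichlet_character_cong:
  assumes "\<xi> \<in> dirichlet_characters q" "[m = n] (mod int q)"
  shows "\<xi> m = \<xi> n"
  using assms dirichlet_character_mod unfolding cong_def by metis

lemma dirichlet_character_eq_0_iff:
  assumes "\<xi> \<in> dirichlet_characters q"
  shows "\<xi> n = 0 \<longleftrightarrow> \<not> coprime n (int q)"
  using assms unfolding dirichlet_characters_def by blast

text \<open>
  A character of the unit group of the residue ring, composed with reduction modulo \<open>q\<close> and extended
  by zero, is a Dirichlet character.
\<close>
lemma dirichlet_characters_separate:
  assumes q: "q > 0" and n: "coprime n (int q)" "\<not> [n = 1] (mod int q)"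
  shows "\<exists>\<xi>\<in>dirichlet_characters q. \<xi> n \<noteq> 1"
proof -
  have "q > 1" using q n(2) by (cases "q = 1") auto
  define R where "R = residue_ring (int q)"
  interpret residues "int q" R
    using \<open>q > 1\<close> by (unfold_locales) (simp_all add: R_def)
  interpret U: comm_group "units_of R" by (rule units_comm_group)
  have carr: "carrier (units_of R) = {x. 0 < x \<and> x < int q \<and> coprime x (int q)}"
    by (simp add: units_of_carrier res_units_eq)
  have mult: "x \<otimes>\<^bsub>units_of R\<^esub> y = (x * y) mod int q" for x y
    by (simp add: units_of_mult res_mult_eq)
  have red: "m mod int q \<in> carrier (units_of R)" if "coprime m (int q)" for m
  proof -
    have "m mod int q \<noteq> 0" using that \<open>q > 1\<close> by (auto simp: mod_eq_0_iff_dvd)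
    then have "0 < m mod int q"
      using q pos_mod_sign[of "int q" m] by linarith
    then show ?thesis using that q by (simp add: carr)
  qed
  have "finite (carrier (units_of R))" by (simp add: units_of_carrier)
  moreover have "n mod int q \<noteq> \<one>\<^bsub>units_of R\<^esub>"
    using n(2) \<open>q > 1\<close> by (simp add: units_of_one res_one_eq cong_def)
  ultimately obtain f where f: "group_character (units_of R) f" "f (n mod int q) \<noteq> 1"
    using U.group_characters_separate red[OF n(1)] by blast
  define \<xi> where "\<xi> m = (if coprime m (int q) then f (m mod int q) else 0)" for m
  have "\<xi> (m * k) = \<xi> m * \<xi> k" for m k
  proof (cases "coprime m (int q) \<and> coprime k (int q)")
    case True
    then have "f ((m mod int q) \<otimes>\<^bsub>units_of R\<^esub> (k mod int q)) = f (m mod int q) * f (k mod int q)"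
      using f(1) red by (simp add: group_character_def)
    then show ?thesis using True by (simp add: \<xi>_def mult mod_mult_eq)
  qed (auto simp: \<xi>_def)
  moreover have "\<xi> (m + int q) = \<xi> m" for m
    by (simp add: \<xi>_def coprime_iff_gcd_eq_1)
  moreover have "\<xi> m \<noteq> 0 \<longleftrightarrow> coprime m (int q)" for m
    using f(1) red by (simp add: \<xi>_def group_character_def)
  ultimately have "\<xi> \<in> dirichlet_characters q"
    unfolding dirichlet_characters_def by blast
  moreover have "\<xi> n \<noteq> 1" using n f by (simp add: \<xi>_def)
  ultimately show ?thesis by blast
qed

lemma dirichlet_character_norm:
  assumes "\<xi> \<in> dirichlet_characters q" "q > 0" "coprime n (int q)"
  shows "norm (\<xi> n) = 1"
  using power_eq_1_iff[OF dirichlet_character_power_totient[OF assms]] assms(2) by simp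

text \<open>
  Multiplication by \<open>m\<close> permutes the residues, so the sum is equal to \<open>\<xi> m\<close> times itself.
\<close>
lemma sum_residues_character_eq_0:
  assumes \<xi>: "\<xi> \<in> dirichlet_characters q" and q: "q > 0"
    and m: "coprime m (int q)" "\<xi> m \<noteq> 1"
  shows "(\<Sum>n\<in>{0..<int q}. \<xi> n) = 0"
proof -
  let ?g = "\<lambda>n. m * n mod int q"
  have "inj_on ?g {0..<int q}"
  proof (rule inj_onI)
    fix x y assume xy: "x \<in> {0..<int q}" "y \<in> {0..<int q}" "?g x = ?g y"
    then have "[x = y] (mod int q)" using m(1) by (simp add: cong_def[symmetric] cong_mult_lcancel)
    then show "x = y" using xy by (simp add: cong_def)
  qed
  moreover have "?g ` {0..<int q} \<subseteq> {0..<int q}" using q by auto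
  ultimately have "bij_betw ?g {0..<int q} {0..<int q}"
    by (simp add: bij_betw_def endo_inj_surj)
  then have "(\<Sum>n\<in>{0..<int q}. \<xi> n) = (\<Sum>n\<in>{0..<int q}. \<xi> (?g n))"
    by (rule sum.reindex_bij_betw[symmetric])
  also have "\<dots> = \<xi> m * (\<Sum>n\<in>{0..<int q}. \<xi> n)"
    using \<xi> dirichlet_character_mod[OF \<xi>]
    by (simp add: sum_distrib_left dirichlet_characters_def)
  finally show ?thesis using m(2) by simp
qed

text \<open>
  The dual argument: multiplication by a character \<open>\<psi>\<close> with \<open>\<psi> n \<noteq> 1\<close> permutes the characters.
\<close>
lemma sum_dirichlet_characters_eq_0:
  assumes q: "q > 0" and n: "\<not> [n = 1] (mod int q)"
  shows "(\<Sum>\<xi>\<in>dirichlet_characters q. \<xi> n) = 0"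
proof (cases "coprime n (int q)")
  case False
  then show ?thesis by (intro sum.neutral) (auto simp: dirichlet_characters_def)
next
  case True
  let ?D = "dirichlet_characters q"
  obtain \<psi> where \<psi>: "\<psi> \<in> ?D" "\<psi> n \<noteq> 1"
    using dirichlet_characters_separate[OF q True n] by blast
  let ?g = "\<lambda>\<xi> m. \<psi> m * \<xi> m"
  have "inj_on ?g ?D"
  proof (rule inj_onI)
    fix \<xi> \<xi>' assume c: "\<xi> \<in> ?D" "\<xi>' \<in> ?D" and eq: "?g \<xi> = ?g \<xi>'"
    show "\<xi> = \<xi>'"
    proof
      fix m
      show "\<xi> m = \<xi>' m"
      proof (cases "coprime m (int q)")
        case True
        then have "\<psi> m \<noteq> 0" using \<psi>(1) by (simp add: dirichlet_characters_def)
        then show ?thesis using fun_cong[OF eq, of m] by simp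
      next
        case False
        then have "\<xi> m = 0" "\<xi>' m = 0" using c by (simp_all add: dirichlet_character_eq_0_iff)
        then show ?thesis by simp
      qed
    qed
  qed
  moreover have "?g ` ?D \<subseteq> ?D" using \<psi>(1) by (auto simp: dirichlet_characters_def)
  ultimately have "bij_betw ?g ?D ?D"
    using finite_dirichlet_characters[OF q] by (simp add: bij_betw_def endo_inj_surj)
  then have "(\<Sum>\<xi>\<in>?D. \<xi> n) = (\<Sum>\<xi>\<in>?D. ?g \<xi> n)"
    by (rule sum.reindex_bij_betw[symmetric])
  also have "\<dots> = \<psi> n * (\<Sum>\<xi>\<in>?D. \<xi> n)" by (simp add: sum_distrib_left)
  finally show ?thesis using \<psi>(2) by simp
qed

text \<open>
  The double sum of \<open>\<xi> n\<close> over characters and residues is evaluated in both orders. Summing over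
  residues first, only the principal character contributes, giving \<open>totient q\<close>; summing over
  characters first, only the residue of \<open>1\<close> contributes, giving the number of characters.
\<close>
lemma card_dirichlet_characters:
  assumes q: "q > 0"
  shows "card (dirichlet_characters q) = totient q"
proof -
  let ?D = "dirichlet_characters q"
  define \<xi>0 :: "int \<Rightarrow> complex" where "\<xi>0 n = (if coprime n (int q) then 1 else 0)" for n
  have shift: "coprime (n + int q) (int q) \<longleftrightarrow> coprime n (int q)" for n
    by (simp add: coprime_iff_gcd_eq_1)
  have \<xi>0: "\<xi>0 \<in> ?D" by (simp add: dirichlet_characters_def \<xi>0_def shift)
  have fin: "finite ?D" by (rule finite_dirichlet_characters[OF q])
  have "{n \<in> {0..<int q}. coprime n (int q)} = (\<lambda>n. int n mod int q) ` totatives q"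
  proof (cases "q = 1")
    case True
    then show ?thesis by auto
  next
    case False
    then have q1: "q > 1" using q by simp
    show ?thesis
    proof (intro equalityI subsetI)
      fix n assume n: "n \<in> {n \<in> {0..<int q}. coprime n (int q)}"
      then have "nat n \<in> totatives q"
        using q1 by (cases "n = 0") (auto simp: in_totatives_iff simp flip: coprime_int_iff)
      moreover have "n = int (nat n) mod int q" using n by simp
      ultimately show "n \<in> (\<lambda>n. int n mod int q) ` totatives q" by blast
    next
      fix n assume "n \<in> (\<lambda>n. int n mod int q) ` totatives q"
      then show "n \<in> {n \<in> {0..<int q}. coprime n (int q)}"
        using q by (auto simp: in_totatives_iff)
    qed
  qed
  moreover have "inj_on (\<lambda>n. int n mod int q) (totatives q)"
  proof (rule inj_onI)
    fix m n assume mn: "m \<in> totatives q" "n \<in> totatives q" "int m mod int q = int n mod int q"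
    have "m = n" if "q = 1" using mn that by simp
    moreover have "m = n" if "q > 1"
      using mn totatives_less[OF _ that] by (metis mod_less of_nat_eq_iff of_nat_mod)
    ultimately show "m = n" using q by linarith
  qed
  ultimately have "card {n \<in> {0..<int q}. coprime n (int q)} = totient q"
    by (simp add: card_image totient_def)
  then have principal: "(\<Sum>n\<in>{0..<int q}. \<xi>0 n) = of_nat (totient q)"
    by (simp add: \<xi>0_def sum.If_cases Int_def)
  have other: "(\<Sum>n\<in>{0..<int q}. \<xi> n) = 0" if \<xi>: "\<xi> \<in> ?D" "\<xi> \<noteq> \<xi>0" for \<xi>
  proof -
    obtain m where m: "\<xi> m \<noteq> \<xi>0 m" using \<xi>(2) by blast
    then have "coprime m (int q)" "\<xi> m \<noteq> 1"
      using dirichlet_character_eq_0_iff[OF \<xi>(1), of m] by (auto simp: \<xi>0_def split: if_splits)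
    then show ?thesis using sum_residues_character_eq_0[OF \<xi>(1) q] by blast
  qed
  have "of_nat (totient q) = (\<Sum>\<xi>\<in>?D. if \<xi> = \<xi>0 then of_nat (totient q) else (0::complex))"
    using fin \<xi>0 by simp
  also have "\<dots> = (\<Sum>\<xi>\<in>?D. \<Sum>n\<in>{0..<int q}. \<xi> n)"
    using principal other by (intro sum.cong) auto
  also have "\<dots> = (\<Sum>n\<in>{0..<int q}. \<Sum>\<xi>\<in>?D. \<xi> n)" by (rule sum.swap)
  also have "\<dots> = (\<Sum>n\<in>{0..<int q}. if n = 1 mod int q then of_nat (card ?D) else 0)"
  proof (intro sum.cong refl)
    fix n assume n: "n \<in> {0..<int q}"
    show "(\<Sum>\<xi>\<in>?D. \<xi> n) = (if n = 1 mod int q then of_nat (card ?D) else 0)"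
    proof (cases "n = 1 mod int q")
      case True
      then have "\<xi> n = 1" if "\<xi> \<in> ?D" for \<xi>
        using that dirichlet_character_mod dirichlet_character_one by metis
      then have "(\<Sum>\<xi>\<in>?D. \<xi> n) = (\<Sum>\<xi>\<in>?D. 1)" by (intro sum.cong) auto
      then show ?thesis using True by simp
    next
      case False
      then show ?thesis
        using n sum_dirichlet_characters_eq_0[OF q] by (simp add: cong_def)
    qed
  qed
  also have "\<dots> = of_nat (card ?D)" using q by simp
  finally show ?thesis by (metis of_nat_eq_iff)
qed

lemma sum_dirichlet_characters:
  assumes "q > 0"
  shows "(\<Sum>\<xi>\<in>dirichlet_characters q. \<xi> n) =
           (if [n = 1] (mod int q) then of_nat (totient q) else 0)"
proof (cases "[n = 1] (mod int q)")
  case True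
  then have "\<xi> n = 1" if "\<xi> \<in> dirichlet_characters q" for \<xi>
    using that dirichlet_character_cong dirichlet_character_one by metis
  then have "(\<Sum>\<xi>\<in>dirichlet_characters q. \<xi> n) = (\<Sum>\<xi>\<in>dirichlet_characters q. 1)"
    by (intro sum.cong) auto
  then show ?thesis using True card_dirichlet_characters[OF assms] by simp
qed (simp add: sum_dirichlet_characters_eq_0 assms)

text \<open>
  The factor \<open>(1 + \<xi> (-1)) / 2\<close> selects the even characters, and \<open>cnj (\<xi> a) = \<xi> b\<close> for an
  inverse \<open>b\<close> of \<open>a\<close> modulo \<open>q\<close>; both resulting sums run over all characters. If \<open>a \<equiv> -a\<close>, that is
  for \<open>q \<le> 2\<close>, both indicators are true at once and the formula counts the residue class twice.
\<close>
lemma sum_even_dirichlet_characters: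
  assumes q: "q > 0" and a: "coprime a (int q)"
  shows "(\<Sum>\<xi> | \<xi> \<in> dirichlet_characters q \<and> \<xi> (-1) = 1. cnj (\<xi> a) * \<xi> n) =
           of_nat (totient q) / 2 *
             (of_bool [n = a] (mod int q) + of_bool [n = - a] (mod int q))"
proof -
  let ?D = "dirichlet_characters q"
  obtain b where b: "[a * b = 1] (mod int q)"
    using cong_solve_coprime_int[OF a] by blast
  have mult: "\<xi> (m * k) = \<xi> m * \<xi> k" if "\<xi> \<in> ?D" for \<xi> m k
    using that by (simp add: dirichlet_characters_def)
  have cnj: "cnj (\<xi> a) = \<xi> b" if "\<xi> \<in> ?D" for \<xi>
  proof -
    have "\<xi> a * cnj (\<xi> a) = 1"
      using dirichlet_character_norm[OF that q a] by (simp add: complex_norm_square[symmetric])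
    moreover have "\<xi> a * \<xi> b = 1"
      using dirichlet_character_cong[OF that b] mult[OF that] dirichlet_character_one[OF that] by simp
    ultimately show ?thesis by (metis mult_cancel_left mult_zero_left zero_neq_one)
  qed
  have sign: "\<xi> (-1) = 1 \<or> \<xi> (-1) = -1" if "\<xi> \<in> ?D" for \<xi>
    using mult[OF that, of "-1" "-1"] dirichlet_character_one[OF that]
    by (simp add: square_eq_1_iff eq_commute[of 1])
  have shift: "[b * n = 1] (mod int q) \<longleftrightarrow> [n = a] (mod int q)" for n
  proof
    assume "[b * n = 1] (mod int q)"
    then have "[a * (b * n) = a * 1] (mod int q)" by (rule cong_scalar_left)
    moreover have "[a * b * n = 1 * n] (mod int q)" using b by (rule cong_scalar_right)
    ultimately show "[n = a] (mod int q)"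
      by (simp add: mult.assoc) (metis cong_sym cong_trans)
  next
    assume "[n = a] (mod int q)"
    then have "[b * n = b * a] (mod int q)" by (rule cong_scalar_left)
    then show "[b * n = 1] (mod int q)" using b by (metis cong_trans mult.commute)
  qed
  have neg: "[- n = a] (mod int q) \<longleftrightarrow> [n = - a] (mod int q)"
    using cong_minus_minus_iff[of n "- a" "int q"] by simp
  have "(\<Sum>\<xi> | \<xi> \<in> ?D \<and> \<xi> (-1) = 1. cnj (\<xi> a) * \<xi> n) =
      (\<Sum>\<xi>\<in>?D. if \<xi> (-1) = 1 then cnj (\<xi> a) * \<xi> n else 0)"
    by (simp add: sum.inter_filter finite_dirichlet_characters[OF q])
  also have "\<dots> = (\<Sum>\<xi>\<in>?D. (\<xi> (b * n) + \<xi> (b * (- n))) / 2)"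
  proof (intro sum.cong refl)
    fix \<xi> assume \<xi>: "\<xi> \<in> ?D"
    have "\<xi> (- n) = \<xi> (-1) * \<xi> n" using mult[OF \<xi>, of "-1" n] by simp
    then show "(if \<xi> (-1) = 1 then cnj (\<xi> a) * \<xi> n else 0) = (\<xi> (b * n) + \<xi> (b * (- n))) / 2"
      using sign[OF \<xi>] unfolding mult[OF \<xi>] cnj[OF \<xi>] by auto
  qed
  also have "\<dots> = ((\<Sum>\<xi>\<in>?D. \<xi> (b * n)) + (\<Sum>\<xi>\<in>?D. \<xi> (b * (- n)))) / 2"
    by (simp add: sum.distrib flip: sum_divide_distrib)
  also have "\<dots> = of_nat (totient q) / 2 *
      (of_bool [n = a] (mod int q) + of_bool [n = - a] (mod int q))"
    by (simp only: sum_dirichlet_characters[OF q] shift neg) auto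
  finally show ?thesis .
qed

section \<open>The logarithmic series on the unit circle\<close>

text \<open>
  On the circle the series converges only conditionally. Along the segment from \<open>0\<close> to \<open>z\<close> the
  remainder after \<open>N\<close> terms has derivative \<open>z (t z)^N / (1 - t z)\<close> in \<open>t\<close>, of norm at most
  \<open>t^N / \<delta>\<close> where \<open>\<delta> > 0\<close> bounds \<open>1 - t z\<close> away from zero; integrating bounds the
  remainder at \<open>t = 1\<close> by \<open>1 / (\<delta> (N + 1))\<close>. This gives convergence and the value together.
\<close>
lemma Ln_series_boundary:
  assumes z: "norm z \<le> 1" "z \<noteq> 1"
  shows "(\<lambda>n. z ^ Suc n / of_nat (Suc n)) sums (- Ln (1 - z))"
proof -
  \<comment> \<open>The unit disc touches the line \<open>Re z = 1\<close> only at \<open>1\<close>.\<close>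
  have Rez: "Re z < 1"
  proof -
    have "Re z \<noteq> 1"
    proof
      assume "Re z = 1"
      then have "Im z = 0" using z(1) abs_Im_le_cmod[of z] cmod_power2[of z]
        by (smt (verit) power2_less_eq_zero_iff one_power2 power_mono norm_ge_zero)
      then show False using \<open>Re z = 1\<close> z(2) by (simp add: complex_eq_iff)
    qed
    then show ?thesis using z(1) complex_Re_le_cmod[of z] by linarith
  qed
  \<comment> \<open>If \<open>Re z \<le> 0\<close>, the point \<open>1 - t z\<close> has smallest real part at \<open>t = 0\<close>, otherwise at \<open>t = 1\<close>.\<close>
  define \<delta> where "\<delta> = min 1 (1 - Re z)"
  have \<delta>: "\<delta> > 0" using Rez by (simp add: \<delta>_def)
  have Re: "Re (1 - of_real t * z) \<ge> \<delta>" if "0 \<le> t" "t \<le> 1" for t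
  proof (cases "Re z \<ge> 0")
    case True
    then have "t * Re z \<le> 1 * Re z" using that by (intro mult_right_mono)
    then show ?thesis by (simp add: \<delta>_def)
  next
    case False
    then have "t * Re z \<le> 0" using that by (simp add: mult_nonneg_nonpos)
    then show ?thesis by (simp add: \<delta>_def)
  qed
  define r where
    "r = (\<lambda>N t. - Ln (1 - of_real t * z) - (\<Sum>n<N. (of_real t * z) ^ Suc n / of_nat (Suc n)))"
  have bound: "norm (r N 1) \<le> inverse \<delta> * inverse (of_nat (Suc N))" for N
  proof -
    have deriv: "(r N has_vector_derivative z * (of_real t * z) ^ N / (1 - of_real t * z)) (at t)"
      if "0 \<le> t" "t \<le> 1" for t
    proof -
      have "Re (1 - of_real t * z) > 0" using Re[OF that] \<delta> by linarith
      then have nz: "1 - of_real t * z \<notin> \<real>\<^sub>\<le>\<^sub>0" "1 - of_real t * z \<noteq> 0"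
        by (metis complex_nonpos_Reals_iff not_le, metis less_irrefl zero_complex.sel(1))
      have summand: "((\<lambda>u. (u * z) ^ Suc n / of_nat (Suc n)) has_field_derivative z * (of_real t * z) ^ n)
          (at (of_real t))" for n
        by (rule derivative_eq_intros refl | simp del: of_nat_Suc)+
      have "((\<lambda>u. - Ln (1 - u * z)) has_field_derivative z / (1 - of_real t * z)) (at (of_real t))"
        using nz by (auto intro!: derivative_eq_intros simp: divide_inverse)
      from DERIV_diff[OF this DERIV_sum[OF summand]]
      have "((\<lambda>u. - Ln (1 - u * z) - (\<Sum>n<N. (u * z) ^ Suc n / of_nat (Suc n)))
          has_field_derivative
            (z / (1 - of_real t * z) - (\<Sum>n<N. z * (of_real t * z) ^ n))) (at (of_real t))" .
      moreover have "z / (1 - of_real t * z) - (\<Sum>n<N. z * (of_real t * z) ^ n) =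
          z * (of_real t * z) ^ N / (1 - of_real t * z)"
      proof -
        have "(1 - of_real t * z) * (\<Sum>n<N. (of_real t * z) ^ n) = 1 - (of_real t * z) ^ N"
          by (rule one_diff_power_eq[symmetric])
        then have "(\<Sum>n<N. (of_real t * z) ^ n) = (1 - (of_real t * z) ^ N) / (1 - of_real t * z)"
          using nz by (metis nonzero_mult_div_cancel_left)
        then show ?thesis
          by (simp add: diff_divide_distrib right_diff_distrib flip: sum_distrib_left)
      qed
      ultimately show ?thesis
        unfolding r_def by (simp only:) (rule has_vector_derivative_real_field)
    qed
    have "norm (r N 1 - r N 0) \<le> inverse \<delta> * (1 ^ Suc N / of_nat (Suc N)) - inverse \<delta> * (0 ^ Suc N / of_nat (Suc N))"
    proof (rule differentiable_bound_general)
      show "continuous_on {0..1} (r N)"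
        using deriv by (intro continuous_at_imp_continuous_on ballI)
          (auto intro: has_vector_derivative_continuous)
      show "continuous_on {0..1} (\<lambda>t. inverse \<delta> * (t ^ Suc N / of_nat (Suc N)))"
        by (intro continuous_intros) simp
      show "((\<lambda>t. inverse \<delta> * (t ^ Suc N / of_nat (Suc N))) has_vector_derivative
          inverse \<delta> * t ^ N) (at t)" for t
        unfolding has_real_derivative_iff_has_vector_derivative[symmetric]
        by (rule derivative_eq_intros refl | simp add: field_simps del: of_nat_Suc power_Suc)+
      fix t :: real assume t: "0 < t" "t < 1"
      show "(r N has_vector_derivative z * (of_real t * z) ^ N / (1 - of_real t * z)) (at t)"
        using deriv t by simp
      have "norm (z * (of_real t * z) ^ N) \<le> t ^ N"
        using z(1) t by (simp add: norm_mult norm_power power_mult_distrib)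
          (metis mult.assoc mult.commute mult_left_le norm_ge_zero power_le_one zero_le_power less_eq_real_def mult_le_one)
      moreover have "\<delta> \<le> norm (1 - of_real t * z)"
        using Re[of t] t complex_Re_le_cmod[of "1 - of_real t * z"] by linarith
      ultimately show "norm (z * (of_real t * z) ^ N / (1 - of_real t * z)) \<le> inverse \<delta> * t ^ N"
        using \<delta> t frac_le[of "t ^ N" "norm (z * (of_real t * z) ^ N)" \<delta> "norm (1 - of_real t * z)"]
        by (simp add: norm_divide divide_inverse norm_mult norm_inverse mult.commute)
    qed simp
    then show ?thesis by (simp add: r_def divide_inverse)
  qed
  have "(\<lambda>N. inverse \<delta> * inverse (of_nat (Suc N))) \<longlonglongrightarrow> inverse \<delta> * 0"
    by (intro tendsto_intros LIMSEQ_inverse_real_of_nat)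
  then have "(\<lambda>N. r N 1) \<longlonglongrightarrow> 0"
    using bound by (intro Lim_null_comparison[of "\<lambda>N. r N 1" "\<lambda>N. inverse \<delta> * inverse (of_nat (Suc N))"]) auto
  then have "(\<lambda>N. - Ln (1 - z) - r N 1) \<longlonglongrightarrow> - Ln (1 - z) - 0"
    by (intro tendsto_intros)
  then show ?thesis by (simp add: sums_def r_def)
qed

text \<open>
  The real part of the previous series at \<open>cis \<theta>\<close>, because \<open>2 - 2 cos \<theta>\<close> is the square
  of the norm of \<open>1 - cis \<theta>\<close>.
\<close>
lemma cos_series:
  assumes "cos \<theta> \<noteq> 1"
  shows "(\<lambda>n. cos (real (Suc n) * \<theta>) / real (Suc n)) sums (- ln (2 - 2 * cos \<theta>) / 2)"
proof -
  have ne: "cis \<theta> \<noteq> 1" using assms by (metis cis.sel(1) one_complex.sel(1))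
  have "norm (1 - cis \<theta>) ^ 2 = 2 - 2 * cos \<theta>"
    unfolding cmod_power2 using sin_cos_squared_add[of \<theta>]
    by (simp add: power2_eq_square algebra_simps)
  then have "ln (2 - 2 * cos \<theta>) = ln (norm (1 - cis \<theta>) ^ 2)" by simp
  also have "\<dots> = 2 * ln (norm (1 - cis \<theta>))" using ne by (subst ln_realpow) auto
  finally have "Re (- Ln (1 - cis \<theta>)) = - ln (2 - 2 * cos \<theta>) / 2"
    using ne by simp
  moreover have "(\<lambda>n. Re (cis \<theta> ^ Suc n / of_nat (Suc n))) sums Re (- Ln (1 - cis \<theta>))"
    by (intro sums_Re Ln_series_boundary) (use ne in auto)
  moreover have "Re (cis \<theta> ^ Suc n / of_nat (Suc n)) = cos (real (Suc n) * \<theta>) / real (Suc n)" for n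
    unfolding Complex.DeMoivre by (simp only: Re_divide_of_nat cis.sel)
  ultimately show ?thesis by (simp only:)
qed

lemma sum_cos_roots_of_unity:
  assumes q: "q > 0"
  shows "(\<Sum>u<q. cos (2 * pi * real u * real_of_int m / real q)) = real q * of_bool (int q dvd m)"
proof -
  define w where "w = cis (2 * pi * real_of_int m / real q)"
  have pow: "cis (2 * pi * real u * real_of_int m / real q) = w ^ u" for u
    by (simp add: w_def Complex.DeMoivre mult_ac)
  have "(\<Sum>u<q. w ^ u) = of_real (real q * of_bool (int q dvd m))"
  proof (cases "int q dvd m")
    case True
    then obtain k where "m = int q * k" by blast
    then have "w = cis (2 * pi * of_int k)" using q by (simp add: w_def field_simps)
    also have "\<dots> = 1" by (simp add: cis_multiple_2pi)
    finally show ?thesis using True by simp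
  next
    case False
    have "w \<noteq> 1"
    proof
      assume "w = 1"
      then have "cos (2 * pi * real_of_int m / real q) = 1"
        by (metis w_def cis.sel(1) one_complex.sel(1))
      then obtain k :: int where "2 * pi * real_of_int m / real q = of_int k * 2 * pi"
        using cos_one_2pi_int by auto
      then have "real_of_int m = real_of_int (k * int q)" using q by (simp add: field_simps)
      then show False using False by (metis dvd_triv_right of_int_eq_iff)
    qed
    moreover have "w ^ q = 1"
    proof -
      have "w ^ q = cis (2 * pi * of_int m)" unfolding w_def Complex.DeMoivre using q by (simp add: field_simps)
      then show ?thesis by (simp add: cis_multiple_2pi)
    qed
    ultimately show ?thesis using False by (simp add: geometric_sum)
  qed
  then have "Re (\<Sum>u<q. w ^ u) = real q * of_bool (int q dvd m)" by simp
  then show ?thesis by (simp add: pow[symmetric] Re_sum)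
qed

section \<open>Polygamma values as sums over residue classes\<close>

lemma Delta_eq_Polygamma:
  assumes "\<alpha> \<notin> \<int>"
  shows "Delta j \<alpha> = 2 * Polygamma (j - 1) 1 - Polygamma (j - 1) (1 - \<alpha>) - Polygamma (j - 1) \<alpha>"
proof -
  have higher: "(deriv ^^ n) digamma z = Polygamma n z" if z: "z \<notin> \<int>\<^sub>\<le>\<^sub>0" for n z
  proof -
    have dig: "digamma w = Digamma w" if "w \<notin> \<int>\<^sub>\<le>\<^sub>0" for w :: complex
      using DERIV_imp_deriv[OF has_field_derivative_Gamma[OF that, of UNIV]] Gamma_nonzero[OF that]
      by (simp add: digamma_def)
    have "open (- (\<int>\<^sub>\<le>\<^sub>0 :: complex set))"
      by (simp add: closed_nonpos_Ints open_Compl)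
    then have "eventually (\<lambda>w. digamma w = Digamma w) (nhds z)"
      using z dig by (auto simp: eventually_nhds)
    then have "(deriv ^^ n) digamma z = (deriv ^^ n) Digamma z"
      by (rule higher_deriv_cong_ev) simp
    also have "\<dots> = Polygamma n z" using higher_deriv_Polygamma[OF z, of n 0] by simp
    finally show ?thesis .
  qed
  have "1 - \<alpha> \<notin> \<int>"
    using assms Ints_diff[OF Ints_1, of "1 - \<alpha>"] by auto
  then have "1 - \<alpha> \<notin> \<int>\<^sub>\<le>\<^sub>0" "\<alpha> \<notin> \<int>\<^sub>\<le>\<^sub>0"
    using assms nonpos_Ints_subset_Ints by blast+
  moreover have "(1 :: complex) \<notin> \<int>\<^sub>\<le>\<^sub>0" by simp
  ultimately show ?thesis by (simp add: Delta_def higher)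
qed

text \<open>
  A block of \<open>q\<close> consecutive indices meets each residue class exactly once. Together with
  \<open>sums_group\<close> this turns a series over all positive integers, restricted to a class modulo \<open>q\<close>,
  into a series over the block number \<open>k\<close>.
\<close>
lemma sum_residue_class_block:
  fixes f :: "nat \<Rightarrow> 'a::comm_monoid_add"
  assumes r: "1 \<le> r" "r \<le> q"
  shows "(\<Sum>n = k * q..<k * q + q. if [int (Suc n) = int r] (mod int q) then f (Suc n) else 0) = f (k * q + r)"
proof -
  have iff: "[int (Suc n) = int r] (mod int q) \<longleftrightarrow> n = k * q + (r - 1)" if n: "n \<in> {k * q..<k * q + q}" for n
  proof
    assume c: "[int (Suc n) = int r] (mod int q)"
    have "[int (k * q + r) = int r] (mod int q)" by (simp add: cong_def)
    with c have "[int (Suc n) = int (k * q + r)] (mod int q)" by (metis cong_sym cong_trans)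
    then have "int q dvd int (Suc n) - int (k * q + r)" by (simp add: cong_iff_dvd_diff)
    moreover have "\<bar>int (Suc n) - int (t + r)\<bar> < int q" if "n \<in> {t..<t + q}" for t
      using that r by auto
    from this[OF n] have "\<bar>int (Suc n) - int (k * q + r)\<bar> < int q" .
    ultimately have "int (Suc n) - int (k * q + r) = 0"
      using zdvd_imp_le[of "int q" "\<bar>int (Suc n) - int (k * q + r)\<bar>"] by auto
    then have "Suc n = k * q + r" by (simp only: right_minus_eq of_nat_eq_iff)
    then show "n = k * q + (r - 1)" using r by (cases r) simp_all
  next
    assume "n = k * q + (r - 1)"
    then have "Suc n = k * q + r" using r by simp
    then show "[int (Suc n) = int r] (mod int q)" by (simp add: cong_def)
  qed
  have "(\<Sum>n = k * q..<k * q + q. if [int (Suc n) = int r] (mod int q) then f (Suc n) else 0) =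
      (\<Sum>n = k * q..<k * q + q. if n = k * q + (r - 1) then f (Suc n) else 0)"
    using iff by (intro sum.cong) auto
  also have "\<dots> = f (Suc (k * q + (r - 1)))"
  proof -
    have "k * q + (r - 1) \<in> {k * q..<k * q + q}" using r by (cases r) auto
    then show ?thesis by (simp only: sum.delta finite_atLeastLessThan if_True)
  qed
  also have "Suc (k * q + (r - 1)) = k * q + r" using r by (cases r) simp_all
  finally show ?thesis .
qed

text \<open>
  Grouping into blocks of length \<open>q\<close> leaves the terms \<open>1 / (k q + r)^j = q^(-j) / (r/q + k)^j\<close>,
  which are those of the polygamma series at \<open>r/q\<close>.
\<close>
lemma sums_residue_class:
  fixes q r j :: nat
  assumes r: "1 \<le> r" "r \<le> q" and j: "j \<ge> 2"
  shows "(\<lambda>n. if [int (Suc n) = int r] (mod int q) then inverse (of_nat (Suc n) ^ j) else 0) sums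
           ((-1) ^ j * Polygamma (j - 1) (of_nat r / of_nat q) / (of_nat q ^ j * fact (j - 1)) :: complex)"
    (is "?f sums ?s")
proof -
  have "summable (\<lambda>n. inverse (((1::real) + of_nat n) ^ j))"
    using j by (intro Polygamma_converges') simp_all
  then have "summable ?f"
    by (rule summable_comparison_test')
       (auto simp: norm_inverse norm_power simp del: of_nat_Suc, simp add: add.commute)
  then have "?f sums suminf ?f" by (rule summable_sums)
  then have "(\<lambda>k. \<Sum>n = k * q..<k * q + q. ?f n) sums suminf ?f"
    using r by (intro sums_group) auto
  then have 1: "(\<lambda>k. inverse (of_nat (k * q + r) ^ j)) sums suminf ?f"
    using sum_residue_class_block[OF r, of "\<lambda>n. inverse (of_nat n ^ j) :: complex"] by simp
  have "(\<lambda>k. inverse ((of_nat r / of_nat q + of_nat k) ^ Suc (j - 1))) sums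
      ((-1) ^ Suc (j - 1) * Polygamma (j - 1) (of_nat r / of_nat q :: complex) / fact (j - 1))"
    using r j by (intro Polygamma_LIMSEQ) auto
  then have "(\<lambda>k. inverse (of_nat q ^ j) * inverse ((of_nat r / of_nat q + of_nat k) ^ j)) sums
      (inverse (of_nat q ^ j) * ((-1) ^ j * Polygamma (j - 1) (of_nat r / of_nat q :: complex) / fact (j - 1)))"
    using j by (intro sums_mult) simp
  moreover have "inverse (of_nat q ^ j) * inverse ((of_nat r / of_nat q + of_nat k) ^ j) =
      inverse ((of_nat (k * q + r) :: complex) ^ j)" for k
  proof -
    have "(of_nat q :: complex) * (of_nat r / of_nat q + of_nat k) = of_nat (k * q + r)"
      using r by (simp add: field_simps)
    then show ?thesis by (metis inverse_mult_distrib power_mult_distrib)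
  qed
  ultimately have "(\<lambda>k. inverse ((of_nat (k * q + r) :: complex) ^ j)) sums ?s"
    by (simp add: field_simps)
  with 1 have "suminf ?f = ?s" by (rule sums_unique2)
  with \<open>?f sums suminf ?f\<close> show ?thesis by simp
qed

lemma Polygamma_1_eq_zeta:
  assumes "j \<ge> 2"
  shows "Polygamma (j - 1) 1 = (-1) ^ j * fact (j - 1) * riemann_zeta (of_nat j)"
proof -
  have "(\<lambda>k. inverse ((1 + of_nat k) ^ Suc (j - 1))) sums
      ((-1) ^ Suc (j - 1) * Polygamma (j - 1) (1 :: complex) / fact (j - 1))"
    using assms by (intro Polygamma_LIMSEQ) auto
  moreover have "of_nat (Suc k) powr (- of_nat j) = inverse ((1 + of_nat k :: complex) ^ Suc (j - 1))" for k
    using assms by (simp add: powr_minus powr_nat' del: of_nat_Suc) simp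
  ultimately have "riemann_zeta (of_nat j) = (-1) ^ j * Polygamma (j - 1) 1 / fact (j - 1)"
    using assms by (simp add: riemann_zeta_def sums_iff del: of_nat_Suc power_Suc) 
  then show ?thesis by (simp flip: power_mult_distrib add: mult.assoc[symmetric])
qed

lemma sum_even_characters_L:
  fixes a q j :: nat
  assumes a: "1 \<le> a" "a < q" "coprime a q" and j: "j \<ge> 2"
  shows "(\<Sum>\<xi> | \<xi> \<in> dirichlet_characters q \<and> \<xi> (-1) = 1.
             cnj (\<xi> (int a)) * Dirichlet_L (of_nat j) \<xi>) =
           of_nat (totient q) / 2 * ((-1) ^ j / (of_nat q ^ j * fact (j - 1))) *
             (Polygamma (j - 1) (of_nat a / of_nat q) + Polygamma (j - 1) (1 - of_nat a / of_nat q))"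
proof -
  have q: "q > 0" using a by simp
  let ?E = "{\<xi>. \<xi> \<in> dirichlet_characters q \<and> \<xi> (-1) = 1}"
  have L: "(\<lambda>n. \<xi> (int (Suc n)) * inverse (of_nat (Suc n) ^ j)) sums Dirichlet_L (of_nat j) \<xi>"
    if \<xi>: "\<xi> \<in> dirichlet_characters q" for \<xi>
  proof -
    have "norm (\<xi> m) \<le> 1" for m
      using dirichlet_character_norm[OF \<xi> q, of m] dirichlet_character_eq_0_iff[OF \<xi>, of m]
      by (cases "coprime m (int q)") auto
    then have bound: "norm (\<xi> (int (Suc n)) * inverse (of_nat (Suc n) ^ j)) \<le> inverse (real (Suc n) ^ j)" for n
      unfolding norm_mult norm_inverse norm_power norm_of_nat by (intro mult_left_le_one_le) auto
    have "summable (\<lambda>n. inverse (((1::real) + of_nat n) ^ j))"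
      using j by (intro Polygamma_converges') simp_all
    then have "summable (\<lambda>n. inverse (real (Suc n) ^ j))" by simp
    then have "summable (\<lambda>n. \<xi> (int (Suc n)) * inverse (of_nat (Suc n) ^ j))"
      using bound by (rule summable_comparison_test')
    then show ?thesis
      using j by (simp add: Dirichlet_L_def powr_minus powr_nat' summable_sums del: of_nat_Suc)
  qed
  have "(\<lambda>n. \<Sum>\<xi>\<in>?E. cnj (\<xi> (int a)) * (\<xi> (int (Suc n)) * inverse (of_nat (Suc n) ^ j))) sums
      (\<Sum>\<xi>\<in>?E. cnj (\<xi> (int a)) * Dirichlet_L (of_nat j) \<xi>)"
    by (intro sums_sum sums_mult L) auto
  moreover have "(\<Sum>\<xi>\<in>?E. cnj (\<xi> (int a)) * (\<xi> (int (Suc n)) * inverse (of_nat (Suc n) ^ j))) =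
      of_nat (totient q) / 2 *
        ((if [int (Suc n) = int a] (mod int q) then inverse (of_nat (Suc n) ^ j) else 0) +
         (if [int (Suc n) = int (q - a)] (mod int q) then inverse (of_nat (Suc n) ^ j) else 0))" for n
  proof -
    have "[int (Suc n) = int (q - a)] (mod int q) \<longleftrightarrow> [int (Suc n) = - int a] (mod int q)"
      using a by (simp add: cong_def of_nat_diff del: of_nat_Suc) 
    moreover have "(\<Sum>\<xi>\<in>?E. cnj (\<xi> (int a)) * (\<xi> (int (Suc n)) * inverse (of_nat (Suc n) ^ j))) =
        (\<Sum>\<xi>\<in>?E. cnj (\<xi> (int a)) * \<xi> (int (Suc n))) * inverse (of_nat (Suc n) ^ j)"
      by (simp only: sum_distrib_right mult.assoc)
    ultimately show ?thesis
      using a by (subst (asm) sum_even_dirichlet_characters) (auto simp: algebra_simps simp del: of_nat_Suc)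
  qed
  ultimately have 1: "(\<lambda>n. of_nat (totient q) / 2 *
        ((if [int (Suc n) = int a] (mod int q) then inverse (of_nat (Suc n) ^ j) else 0) +
         (if [int (Suc n) = int (q - a)] (mod int q) then inverse (of_nat (Suc n) ^ j) else 0))) sums
      (\<Sum>\<xi>\<in>?E. cnj (\<xi> (int a)) * Dirichlet_L (of_nat j) \<xi>)"
    by (simp only:)
  have refl_eq: "of_nat (q - a) / of_nat q = (1 - of_nat a / of_nat q :: complex)"
    using a by (simp add: of_nat_diff diff_divide_distrib)
  have "(\<lambda>n. of_nat (totient q) / 2 *
        ((if [int (Suc n) = int a] (mod int q) then inverse (of_nat (Suc n) ^ j) else 0) +
         (if [int (Suc n) = int (q - a)] (mod int q) then inverse (of_nat (Suc n) ^ j) else 0))) sums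
      (of_nat (totient q) / 2 *
        ((-1) ^ j * Polygamma (j - 1) (of_nat a / of_nat q) / (of_nat q ^ j * fact (j - 1)) +
         (-1) ^ j * Polygamma (j - 1) (of_nat (q - a) / of_nat q) / (of_nat q ^ j * fact (j - 1)) :: complex))"
    using a j by (intro sums_mult sums_add sums_residue_class) auto
  from sums_unique2[OF 1 this] show ?thesis
    unfolding refl_eq by (simp add: algebra_simps add_divide_distrib)
qed

lemma of_nat_quotient_not_Ints:
  fixes a q :: nat
  assumes "1 \<le> a" "a < q"
  shows "(of_nat a / of_nat q :: 'a::field_char_0) \<notin> \<int>"
proof
  assume "(of_nat a / of_nat q :: 'a) \<in> \<int>"
  then obtain k where "(of_nat a / of_nat q :: 'a) = of_int k" by (elim Ints_cases)
  then have "(of_int (int a) :: 'a) = of_int (k * int q)"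
    using assms by (simp add: field_simps)
  then have "int a = k * int q" by (simp only: of_int_eq_iff)
  then show False using assms by (metis dvd_triv_right int_dvd_int_iff nat_dvd_not_less not_one_le_zero gr0I)
qed

lemma Delta_higher:
  fixes a q j :: nat
  assumes a: "1 \<le> a" "a < q" "coprime a q" and j: "j \<ge> 2"
  shows "Delta j (of_nat a / of_nat q) =
           (-1) ^ j * fact (j - 1) *
             (2 * riemann_zeta (of_nat j)
              - 2 * of_nat q ^ j / of_nat (totient q)
                * (\<Sum>\<xi> | \<xi> \<in> dirichlet_characters q \<and> \<xi> (-1) = 1.
                     cnj (\<xi> (int a)) * Dirichlet_L (of_nat j) \<xi>))"
proof -
  have nz: "(of_nat (totient q) :: complex) \<noteq> 0" "(of_nat q :: complex) \<noteq> 0" using a by auto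
  have sq: "(-1) ^ j * (-1) ^ j = (1 :: complex)" by (simp flip: power_mult_distrib)
  let ?P = "Polygamma (j - 1) (of_nat a / of_nat q) + Polygamma (j - 1) (1 - of_nat a / of_nat q) :: complex"
  have "(-1) ^ j * fact (j - 1) * (2 * of_nat q ^ j / of_nat (totient q) *
      (of_nat (totient q) / 2 * ((-1) ^ j / (of_nat q ^ j * fact (j - 1))) * ?P)) = ((-1) ^ j * (-1) ^ j) * ?P"
    using nz by (simp add: field_simps)
  then show ?thesis
    unfolding sum_even_characters_L[OF a j] Delta_eq_Polygamma[OF of_nat_quotient_not_Ints[OF a(1,2)]]
      Polygamma_1_eq_zeta[OF j] right_diff_distrib
    by (simp add: sq algebra_simps)
qed

section \<open>The digamma function at rational arguments\<close>

lemma cos_root_of_unity_neq_1: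
  fixes u q :: nat
  assumes "1 \<le> u" "u < q"
  shows "cos (2 * pi * real u / real q) \<noteq> 1"
proof
  assume "cos (2 * pi * real u / real q) = 1"
  then obtain k :: int where "2 * pi * real u / real q = of_int k * 2 * pi"
    using cos_one_2pi_int by auto
  then have "real_of_int (int u) = real_of_int (k * int q)"
    using assms by (simp add: field_simps)
  then have "int u = k * int q" by (simp only: of_int_eq_iff)
  then have "q dvd u" by (metis dvd_triv_right int_dvd_int_iff)
  then show False using assms by (simp add: nat_dvd_not_less)
qed

lemma cos_series_root_of_unity:
  fixes u q :: nat
  assumes "1 \<le> u" "u < q"
  shows "(\<lambda>n. cos (2 * pi * real u * real_of_int (int (Suc n)) / real q) / real (Suc n)) sums
           (- ln (2 - 2 * cos (2 * pi * real u / real q)) / 2)"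
  using cos_series[OF cos_root_of_unity_neq_1[OF assms]] by (simp add: mult_ac)

text \<open>
  Summing the cosine series over \<open>0 < u < q\<close> gives \<open>\<Sum> f(m)\<close> with \<open>f(m) = (q [q dvd m] - 1)/m\<close>. Its
  partial sum up to \<open>N q\<close> is \<open>harm N - harm (N q)\<close>, which tends to \<open>- ln q\<close>. The statement is the
  logarithm of the classical product \<open>\<Prod> (1 - \<omega>^u) = q\<close> over the nontrivial powers of a
  primitive \<open>q\<close>-th root of unity \<open>\<omega>\<close>.
\<close>
lemma sum_ln_roots_of_unity:
  fixes q :: nat
  assumes q: "q > 0"
  shows "(\<Sum>u = 1..q - 1. ln (2 - 2 * cos (2 * pi * real u / real q))) = 2 * ln (real q)"
proof -
  define f where "f m = (real q * of_bool [int m = int q] (mod int q) - 1) / real m" for m :: nat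
  define S where "S = (\<Sum>u = 1..q - 1. ln (2 - 2 * cos (2 * pi * real u / real q)))"
  have "(\<lambda>n. \<Sum>u = 1..q - 1. cos (2 * pi * real u * real_of_int (int (Suc n)) / real q) / real (Suc n)) sums
      (\<Sum>u = 1..q - 1. - ln (2 - 2 * cos (2 * pi * real u / real q)) / 2)"
    by (intro sums_sum cos_series_root_of_unity) auto
  moreover have "(\<Sum>u = 1..q - 1. cos (2 * pi * real u * real_of_int (int (Suc n)) / real q) / real (Suc n)) = f (Suc n)" for n
  proof -
    \<comment> \<open>The frequency \<open>u = 0\<close> contributes \<open>1\<close> to the full sum over \<open>u < q\<close>.\<close>
    have "{..<q} = insert 0 {1..q - 1}" using q by auto
    then have "(\<Sum>u = 1..q - 1. cos (2 * pi * real u * real_of_int (int (Suc n)) / real q)) =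
        real q * of_bool (int q dvd int (Suc n)) - 1"
      using sum_cos_roots_of_unity[OF q, of "int (Suc n)"] by (simp del: of_nat_Suc of_int_of_nat_eq)
    moreover have "int q dvd int (Suc n) \<longleftrightarrow> [int (Suc n) = int q] (mod int q)"
      by (simp add: cong_def dvd_eq_mod_eq_0 del: of_nat_Suc)
    ultimately show ?thesis
      by (simp add: f_def del: of_nat_Suc of_int_of_nat_eq flip: sum_divide_distrib)
  qed
  ultimately have "(\<lambda>n. f (Suc n)) sums (- S / 2)"
    by (simp add: S_def sum_negf flip: sum_divide_distrib)
  then have "(\<lambda>k. \<Sum>n = k * q..<k * q + q. f (Suc n)) sums (- S / 2)"
    using q by (rule sums_group)
  then have 1: "(\<lambda>N. \<Sum>k<N. \<Sum>n = k * q..<k * q + q. f (Suc n)) \<longlonglongrightarrow> - S / 2"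
    by (simp add: sums_def)
  have block: "(\<Sum>k<N. \<Sum>n = k * q..<k * q + q. f (Suc n)) = harm N - harm (N * q)" for N
  proof -
    have "(\<Sum>n = k * q..<k * q + q. f (Suc n)) =
        1 / real (Suc k) - (\<Sum>n = k * q..<k * q + q. 1 / real (Suc n))" for k
    proof -
      have "(\<Sum>n = k * q..<k * q + q. f (Suc n)) =
          (\<Sum>n = k * q..<k * q + q. (if [int (Suc n) = int q] (mod int q) then real q / real (Suc n) else 0)
             - 1 / real (Suc n))"
        by (intro sum.cong) (auto simp: f_def diff_divide_distrib simp del: of_nat_Suc)
      also have "\<dots> = real q / real (k * q + q) - (\<Sum>n = k * q..<k * q + q. 1 / real (Suc n))"
        using q by (simp only: sum_subtractf sum_residue_class_block[of q q "\<lambda>m. real q / real m" k])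
      also have "real q / real (k * q + q) = 1 / real (Suc k)"
      proof -
        have "real (k * q + q) = real q * real (Suc k)" by (simp add: algebra_simps)
        then show ?thesis using q by simp
      qed
      finally show ?thesis .
    qed
    then have "(\<Sum>k<N. \<Sum>n = k * q..<k * q + q. f (Suc n)) =
        (\<Sum>k<N. 1 / real (Suc k)) - (\<Sum>n<N * q. 1 / real (Suc n))"
      by (simp only: sum_subtractf sum.nat_group)
    moreover have "harm M = (\<Sum>n<M. 1 / real (Suc n))" for M
      by (induction M) (simp_all add: harm_Suc harm_def inverse_eq_divide)
    ultimately show ?thesis by (simp only:)
  qed
  have h: "(\<lambda>N. harm N - ln (real N)) \<longlonglongrightarrow> euler_mascheroni"
    by (rule euler_mascheroni_LIMSEQ)
  have "filterlim (\<lambda>N. N * q) at_top sequentially"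
    using q by (intro mult_nat_right_at_top)
  then have hq: "(\<lambda>N. harm (N * q) - ln (real (N * q))) \<longlonglongrightarrow> euler_mascheroni"
    by (rule filterlim_compose[OF h])
  have "(\<lambda>N. (harm N - ln (real N)) - (harm (N * q) - ln (real (N * q))) - ln (real q))
      \<longlonglongrightarrow> euler_mascheroni - euler_mascheroni - ln (real q)"
    by (intro tendsto_diff h hq tendsto_const)
  moreover have "eventually (\<lambda>N. (harm N - ln (real N)) - (harm (N * q) - ln (real (N * q))) - ln (real q)
      = harm N - harm (N * q)) sequentially"
    using eventually_gt_at_top[of 0]
    by eventually_elim (use q in \<open>simp add: ln_mult\<close>)
  ultimately have "(\<lambda>N. harm N - harm (N * q)) \<longlonglongrightarrow> euler_mascheroni - euler_mascheroni - ln (real q)"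
    by (rule Lim_transform_eventually)
  then have "(\<lambda>N. harm N - harm (N * q)) \<longlonglongrightarrow> - ln (real q)" by simp
  with 1 have "- S / 2 = - ln (real q)"
    unfolding block by (intro LIMSEQ_unique)
  then show ?thesis by (simp add: S_def)
qed

lemma sums_Digamma_symmetric:
  fixes \<alpha> :: real
  assumes "\<alpha> \<noteq> 0" "\<alpha> \<noteq> 1"
  shows "(\<lambda>k. inverse (\<alpha> + real k) + inverse (1 - \<alpha> + real k) - 2 * inverse (real (Suc k))) sums
           (2 * Digamma 1 - Digamma (1 - \<alpha>) - Digamma \<alpha>)"
proof -
  have D: "(\<lambda>k. inverse (real (Suc k)) - inverse (z + real k)) sums (Digamma z + euler_mascheroni)"
    if "z \<noteq> 0" for z :: real
    using summable_sums[OF summable_Digamma[OF that]] by (simp add: Digamma_def)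
  have "(\<lambda>k. 2 * (inverse (real (Suc k)) - inverse (1 + real k)) - (inverse (real (Suc k)) - inverse (1 - \<alpha> + real k))
      - (inverse (real (Suc k)) - inverse (\<alpha> + real k))) sums
      (2 * (Digamma 1 + euler_mascheroni) - (Digamma (1 - \<alpha>) + euler_mascheroni) - (Digamma \<alpha> + euler_mascheroni))"
    using assms by (intro sums_diff sums_mult D) auto
  moreover have "2 * (Digamma 1 + euler_mascheroni) - (Digamma (1 - \<alpha>) + euler_mascheroni)
      - (Digamma \<alpha> + euler_mascheroni) = 2 * Digamma 1 - Digamma (1 - \<alpha>) - Digamma \<alpha>"
    by (simp add: algebra_simps)
  moreover have "2 * (inverse (real (Suc k)) - inverse (1 + real k)) - (inverse (real (Suc k)) - inverse (1 - \<alpha> + real k))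
      - (inverse (real (Suc k)) - inverse (\<alpha> + real k)) =
      inverse (\<alpha> + real k) + inverse (1 - \<alpha> + real k) - 2 * inverse (real (Suc k))" for k
    by simp
  ultimately show ?thesis by (simp only:)
qed

text \<open>
  By the addition theorem and \<open>sum_cos_roots_of_unity\<close>, the combination
  \<open>\<Sum>\<^sub>u 2 (cos(2 \<pi> a u/q) - 1) cos(2 \<pi> m u/q)\<close> is \<open>q\<close> times
  \<open>[m \<equiv> a] + [m \<equiv> -a] - 2 [m \<equiv> 0]\<close>, the brackets being indicators. The weights
  vanish at \<open>u = 0\<close>, the only frequency at which the cosine series diverges, so dividing by \<open>m\<close> and
  summing over \<open>m\<close> is legitimate. In blocks of length \<open>q\<close> the result is the digamma series.
\<close>
lemma Digamma_symmetric_rational: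
  fixes a q :: nat
  assumes a: "1 \<le> a" "a < q"
  shows "2 * Digamma 1 - Digamma (1 - real a / real q) - Digamma (real a / real q) =
           2 * ln (real q)
             - (\<Sum>u = 1..q - 1. cos (2 * pi * real a * real u / real q)
                  * ln (2 - 2 * cos (2 * pi * real u / real q)))"
proof -
  have q: "q > 0" using a by simp
  define e where "e u m = cos (2 * pi * real u * real_of_int m / real q)" for u m
  define l where "l u = ln (2 - 2 * cos (2 * pi * real u / real q))" for u :: nat
  define d where "d r n = (if [int (Suc n) = int r] (mod int q) then real q / real (Suc n) else 0)"
    for r n :: nat
  have "(\<lambda>n. \<Sum>u = 1..q - 1. 2 * (e u (int a) - 1) * (e u (int (Suc n)) / real (Suc n))) sums
      (\<Sum>u = 1..q - 1. 2 * (e u (int a) - 1) * (- l u / 2))"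
    unfolding e_def l_def by (intro sums_sum sums_mult cos_series_root_of_unity) auto
  moreover have "(\<Sum>u = 1..q - 1. 2 * (e u (int a) - 1) * (e u (int (Suc n)) / real (Suc n))) =
      d a n + d (q - a) n - 2 * d q n" for n
  proof -
    have sum_e: "(\<Sum>u<q. e u m) = real q * of_bool (int q dvd m)" for m
      unfolding e_def by (rule sum_cos_roots_of_unity[OF q])
    have prod: "2 * e u (int a) * e u m = e u (m - int a) + e u (m + int a)" for u m
      using cos_times_cos[of "2 * pi * real u * real_of_int m / real q" "2 * pi * real u * real a / real q"]
      by (simp add: e_def diff_divide_distrib add_divide_distrib algebra_simps)
    have "{..<q} = insert 0 {1..q - 1}" using q by auto
    moreover have "e 0 m = 1" for m by (simp add: e_def)
    ultimately have "(\<Sum>u = 1..q - 1. 2 * (e u (int a) - 1) * e u m) = (\<Sum>u<q. 2 * (e u (int a) - 1) * e u m)" for m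
      by simp
    also have "\<dots> m = (\<Sum>u<q. e u (m - int a)) + (\<Sum>u<q. e u (m + int a)) - 2 * (\<Sum>u<q. e u m)" for m
      by (simp add: sum.distrib sum_subtractf sum_distrib_left prod left_diff_distrib right_diff_distrib
          flip: mult.assoc)
    finally have "(\<Sum>u = 1..q - 1. 2 * (e u (int a) - 1) * e u (int (Suc n))) =
        real q * of_bool (int q dvd int (Suc n) - int a) + real q * of_bool (int q dvd int (Suc n) + int a)
          - 2 * (real q * of_bool (int q dvd int (Suc n)))"
      unfolding sum_e .
    moreover have "int q dvd int (Suc n) - int a \<longleftrightarrow> [int (Suc n) = int a] (mod int q)"
      by (simp only: cong_iff_dvd_diff)
    moreover have "int q dvd int (Suc n) + int a \<longleftrightarrow> [int (Suc n) = int (q - a)] (mod int q)"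
    proof -
      have "int (Suc n) - int (q - a) = int (Suc n) + int a - int q" using a by simp
      then show ?thesis unfolding cong_iff_dvd_diff by (simp only: dvd_diff_left_iff dvd_refl)
    qed
    moreover have "int q dvd int (Suc n) \<longleftrightarrow> [int (Suc n) = int q] (mod int q)"
      by (simp add: cong_def dvd_eq_mod_eq_0 del: of_nat_Suc)
    ultimately have "(\<Sum>u = 1..q - 1. 2 * (e u (int a) - 1) * e u (int (Suc n))) / real (Suc n) =
        d a n + d (q - a) n - 2 * d q n"
      by (simp add: d_def add_divide_distrib diff_divide_distrib del: of_nat_Suc)
    then show ?thesis by (simp add: sum_divide_distrib del: of_nat_Suc)
  qed
  ultimately have "(\<lambda>n. d a n + d (q - a) n - 2 * d q n) sums (\<Sum>u = 1..q - 1. 2 * (e u (int a) - 1) * (- l u / 2))"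
    by (simp only:)
  then have "(\<lambda>k. \<Sum>n = k * q..<k * q + q. d a n + d (q - a) n - 2 * d q n) sums
      (\<Sum>u = 1..q - 1. 2 * (e u (int a) - 1) * (- l u / 2))"
    using q by (rule sums_group)
  moreover have "(\<Sum>n = k * q..<k * q + q. d a n + d (q - a) n - 2 * d q n) =
      inverse (real a / real q + real k) + inverse (1 - real a / real q + real k) - 2 * inverse (real (Suc k))" for k
  proof -
    have block: "(\<Sum>n = k * q..<k * q + q. d r n) = inverse (real r / real q + real k)" if "1 \<le> r" "r \<le> q" for r
    proof -
      have "(\<Sum>n = k * q..<k * q + q. d r n) = real q / real (k * q + r)"
        unfolding d_def by (rule sum_residue_class_block[OF that])
      then show ?thesis using q that by (simp add: field_simps)
    qed
    have "real (q - a) / real q = 1 - real a / real q"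
      using a by (simp add: of_nat_diff diff_divide_distrib)
    then show ?thesis
      using a block[of a] block[of "q - a"] block[of q]
      by (simp add: sum.distrib sum_subtractf flip: sum_distrib_left)
  qed
  ultimately have "(\<lambda>k. inverse (real a / real q + real k) + inverse (1 - real a / real q + real k)
      - 2 * inverse (real (Suc k))) sums (\<Sum>u = 1..q - 1. 2 * (e u (int a) - 1) * (- l u / 2))"
    by (simp only:)
  moreover have "real a / real q \<noteq> 0" "real a / real q \<noteq> 1" using a by auto
  ultimately have "2 * Digamma 1 - Digamma (1 - real a / real q) - Digamma (real a / real q) =
      (\<Sum>u = 1..q - 1. 2 * (e u (int a) - 1) * (- l u / 2))"
    using sums_unique2 sums_Digamma_symmetric by blast
  also have "\<dots> = (\<Sum>u = 1..q - 1. l u - e u (int a) * l u)"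
    by (intro sum.cong) (auto simp: algebra_simps)
  also have "\<dots> = (\<Sum>u = 1..q - 1. l u) - (\<Sum>u = 1..q - 1. e u (int a) * l u)"
    by (rule sum_subtractf)
  also have "(\<Sum>u = 1..q - 1. l u) = 2 * ln (real q)"
    unfolding l_def by (rule sum_ln_roots_of_unity[OF q])
  finally show ?thesis by (simp add: e_def l_def mult_ac)
qed

theorem proposition5p2:
  fixes a q :: nat
  assumes "q \<ge> 2" and "1 \<le> a" and "a < q" and "gcd a q = 1"
  shows "Delta 1 (of_nat a / of_nat q) =
           complex_of_real (2 * ln (real q)
             - (\<Sum>u = 1..q - 1. cos (2 * pi * real a * real u / real q)
                  * ln (2 - 2 * cos (2 * pi * real u / real q)))) \<and>
         (\<forall>j::nat. j \<ge> 2 \<longrightarrow>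
           Delta j (of_nat a / of_nat q) =
             (-1) ^ j * fact (j - 1) *
             (2 * riemann_zeta (of_nat j)
              - 2 * of_nat q ^ j / of_nat (totient q)
                * (\<Sum>\<xi> | \<xi> \<in> dirichlet_characters q \<and> \<xi> (-1) = 1.
                     cnj (\<xi> (int a)) * Dirichlet_L (of_nat j) \<xi>)))"
proof (intro conjI allI impI)
  let ?\<alpha> = "real a / real q"
  have nz: "?\<alpha> \<noteq> 0" "1 - ?\<alpha> \<noteq> 0" using assms by auto
  have "Delta 1 (of_nat a / of_nat q) =
      2 * Digamma 1 - Digamma (1 - of_nat a / of_nat q) - Digamma (of_nat a / of_nat q)"
    using Delta_eq_Polygamma[OF of_nat_quotient_not_Ints[OF assms(2,3)], of 1] by simp
  also have "\<dots> = complex_of_real (2 * Digamma 1 - Digamma (1 - ?\<alpha>) - Digamma ?\<alpha>)"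
    using Polygamma_of_real[OF nz(1), of 0, where 'a = complex]
      Polygamma_of_real[OF nz(2), of 0, where 'a = complex]
      Polygamma_of_real[of "1 :: real" 0, where 'a = complex] by simp
  also have "2 * Digamma 1 - Digamma (1 - ?\<alpha>) - Digamma ?\<alpha> =
      2 * ln (real q) - (\<Sum>u = 1..q - 1. cos (2 * pi * real a * real u / real q)
                  * ln (2 - 2 * cos (2 * pi * real u / real q)))"
    by (rule Digamma_symmetric_rational[OF assms(2,3)])
  finally show "Delta 1 (of_nat a / of_nat q) = complex_of_real (2 * ln (real q)
             - (\<Sum>u = 1..q - 1. cos (2 * pi * real a * real u / real q)
                  * ln (2 - 2 * cos (2 * pi * real u / real q))))" .
next
  fix j :: nat
  assume "j \<ge> 2"
  moreover have "coprime a q" using assms(4) by (simp only: coprime_iff_gcd_eq_1)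
  ultimately show "Delta j (of_nat a / of_nat q) =
             (-1) ^ j * fact (j - 1) *
             (2 * riemann_zeta (of_nat j)
              - 2 * of_nat q ^ j / of_nat (totient q)
                * (\<Sum>\<xi> | \<xi> \<in> dirichlet_characters q \<and> \<xi> (-1) = 1.
                     cnj (\<xi> (int a)) * Dirichlet_L (of_nat j) \<xi>))"
    by (intro Delta_higher assms(2,3))
qed

end
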